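(* Let $\sigma$ be an irreducible normalized multiscale substitution scheme in $\mathbb{R}^d$ and let $\mathcal{S}=\bigcup_{k=0}^\infty F_{ks}(T)\in\mathbb{X}_\sigma^F$ be a stationary tiling, with tile complexity function $c_{\mathcal{S}}$. If $c_{\mathcal{S}}(\ell+1)=c_{\mathcal{S}}(\ell)$ for some $\ell\in\mathbb{N}$, then $c_{\mathcal{S}}(k)=c_{\mathcal{S}}(\ell)$ for all $k\ge\ell$. Moreover, this is the case (i.e. such an $\ell$ exists) if and only if $\sigma$ is commensurable.
   Context: Schemes. A tile in $\mathbb{R}^d$ is a bounded Lebesgue measurable set $T$ of positive measure $\mathrm{vol}\,T$ whose boundary has measure zero. A tessellation of $U\subset\mathbb{R}^d$ is a collection of tiles with pairwise disjoint interiors and union $U$; it is called a patch if $U$ is bounded ($U$ is then the support of the patch) and a tiling if $U=\mathbb{R}^d$. A multiscale substitution scheme $\sigma=(\tau_\sigma,\varrho_\sigma)$ consists of a finite list of prototiles $\tau_\sigma=(T_1,\dots,T_n)$ and, for each $i$, a tessellation $\varrho_\sigma(T_i)$ of $T_i$ all of whose tiles are translates of rescaled prototiles; the list of these rescaled prototiles is $\omega_\sigma(T_i)=(\alpha_{ij}^{(k)}T_j:\ j=1,\dots,n,\ k=1,\dots,k_{ij})$. Here $0<\alpha_{ij}^{(k)}<1$. A translate of $\alpha T_j$, $\alpha>0$, is a tile of type $j$ and scale $\alpha$. Standing assumptions: $\sigma$ is normalized, i.e. $\mathrm{vol}\,T_i=1$ for all $i$; distinct prototiles are geometrically different ($T_i$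 is not a rescaled copy of $T_j$ for $i\ne j$), so the type of a tile is determined by the tile. Graph. The associated graph $G_\sigma$ is the directed weighted multigraph with vertices $1,\dots,n$ and, for each tile $\alpha T_j$ in the list $\omega_\sigma(T_i)$, an edge from $i$ to $j$ of length $\log\frac1\alpha$. Substitution semi-flow. For $t\ge 0$, $F_t(T_i)$ is the patch supported on $e^tT_i$ obtained by starting with $e^tT_i$ and repeatedly substituting (according to the rescaled rule $\varrho_\sigma$) every tile of volume $>1$, until all tiles have volume $\le 1$. In the same way $F_t$ is defined on every tile $T$ that is a translate of $\alpha T_i$ with $0<\alpha\le 1$ ($F_t(T)$ is supported on $e^tT$), on patches of such tiles, and on tilings by such tiles (tile by tile). $\sigma$ is irreducible if for all $i,j$ there is $t>0$ such that $F_t(T_i)$ contains a tile of type $j$. $\sigma$ is incommensurable if there are $i,j$ and $t_1,t_2>0$ with $t_1\notin\mathbb{Q}t_2$ such that $F_{t_1}(T_i)$ contains a tile of type $i$ and unit volume and $F_{t_2}(T_j)$ contains a tile of type $j$ and unit volume; otherwise $\sigma$ is commensurable. Let $\mathscr{S}_{i\to i}$ be the set of $t$ such that $F_t(T_i)$ contains a tile of type $i$ and unit volume. Tiling space. Let $\mathscr{P}_\sigma=\{F_t(T_i): t\ge0,\ i=1,\dots,n\}$. Identify a patch or tiling with the closed set which is the union of the boundaries of its tiles. On closed subsets of $\mathbb{R}^d$ use the metric $D(A_1,A_2)=\inf(\{r>0: A_1\cap B(0,1/r)\subset A_2^{+r},\ A_2\cap B(0,1/r)\subset A_1^{+r}\}\cup\{1\})$,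 where $A^{+r}$ is the $r$-neighborhood of $A$ and $B(x,R)$ is the open Euclidean ball. $\mathbb{X}^F_\sigma$ is the set of all tilings $\mathcal{T}$ of $\mathbb{R}^d$ such that every sub-patch of $\mathcal{T}$ is a limit, with respect to $D$, of translated sub-patches of elements of $\mathscr{P}_\sigma$. A stationary tiling is a tiling $\mathcal{S}\in\mathbb{X}_\sigma^F$ of the form $\mathcal{S}=\bigcup_{k\ge0}F_{a+ks}(T_i)$ with $0<s\in\mathscr{S}_{i\to i}$, $a\ge0$, where $T_i$ is positioned so that the origin is an interior point and the patches $F_{a+ks}(T_i)$, $k\ge0$, are nested (each a sub-patch of the next). It satisfies $F_s(\mathcal{S})=\mathcal{S}$. It is assumed that $s$ is minimal in the sense that the closed path in $G_\sigma$ associated with it (recording the sequence of ancestors of the tile concerned) is not a concatenation of several copies of a single closed path. Every stationary tiling can be written as $\mathcal{S}=\bigcup_{k\ge0}F_{ks}(T)$ (nested union) with $T$ a single tile, a rescaled copy of a prototile. Tile complexity. For $k\ge0$, $c_{\mathcal{S}}(k)$ is the number of distinct tiles, up to translation, in the patch $F_{ks}(T)$ (equivalently, the sum over $j$ of the number of distinct scales in which tiles of type $j$ appear in $F_{ks}(T)$). *)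

theory Defs
  imports "HOL-Analysis.Analysis" "Graph_Theory.Arc_Walk"
begin

text \<open>The ambient space is an arbitrary type of class \<open>euclidean_space\<close>, in the role of
  $\mathbb{R}^d$. Tiles are plain sets, patches and tilings are sets of tiles. Since a tile has
  non-empty interior, no tile can occur twice in a tessellation, so nothing is lost by using sets
  of tiles.\<close>

abbreviation vol :: "'a::euclidean_space set \<Rightarrow> real" where
  "vol \<equiv> measure lebesgue"

definition tile :: "'a::euclidean_space set \<Rightarrow> bool" where
  "tile Q \<longleftrightarrow> bounded Q \<and> Q \<in> sets lebesgue \<and> 0 < vol Q \<and> negligible (frontier Q)"

definition tessellation :: "'a::euclidean_space set \<Rightarrow> 'a set set \<Rightarrow> bool" where
  "tessellation U P \<longleftrightarrow> (\<forall>Q\<in>P. tile Q) \<and>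
     pairwise (\<lambda>Q R. interior Q \<inter> interior R = {}) P \<and> \<Union>P = U"

definition subpatch :: "'a::euclidean_space set set \<Rightarrow> 'a set set \<Rightarrow> bool" where
  "subpatch P P' \<longleftrightarrow> P \<subseteq> P' \<and> bounded (\<Union>P)"

definition translate :: "'a::euclidean_space \<Rightarrow> 'a set \<Rightarrow> 'a set" where
  "translate x A = (+) x ` A"

definition homothet :: "'a::euclidean_space \<Rightarrow> real \<Rightarrow> 'a set \<Rightarrow> 'a set" where
  "homothet x \<alpha> A = (\<lambda>v. x + \<alpha> *\<^sub>R v) ` A"

text \<open>Types are the indices \<open>0, \<dots>, n - 1\<close> of the prototiles. \<open>substitution \<sigma> i\<close> is the tessellation
  $\varrho_\sigma(T_i)$; it is only meaningful for \<open>i < num_types \<sigma>\<close>.\<close>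

record 'a scheme =
  prototiles :: "'a set list"
  substitution :: "nat \<Rightarrow> 'a set set"

abbreviation num_types :: "'a scheme \<Rightarrow> nat" where
  "num_types \<sigma> \<equiv> length (prototiles \<sigma>)"

abbreviation proto :: "'a scheme \<Rightarrow> nat \<Rightarrow> 'a set" where
  "proto \<sigma> i \<equiv> prototiles \<sigma> ! i"

definition tile_of :: "'a::euclidean_space scheme \<Rightarrow> nat \<Rightarrow> real \<Rightarrow> 'a set \<Rightarrow> bool" where
  "tile_of \<sigma> j \<alpha> Q \<longleftrightarrow> j < num_types \<sigma> \<and> 0 < \<alpha> \<and> (\<exists>x. Q = homothet x \<alpha> (proto \<sigma> j))"

definition has_type :: "'a::euclidean_space scheme \<Rightarrow> nat \<Rightarrow> 'a set \<Rightarrow> bool" where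
  "has_type \<sigma> j Q \<longleftrightarrow> (\<exists>\<alpha>. tile_of \<sigma> j \<alpha> Q)"

definition substitution_scheme :: "'a::euclidean_space scheme \<Rightarrow> bool" where
  "substitution_scheme \<sigma> \<longleftrightarrow> prototiles \<sigma> \<noteq> [] \<and>
     (\<forall>i < num_types \<sigma>. tile (proto \<sigma> i) \<and>
        finite (substitution \<sigma> i) \<and>
        tessellation (proto \<sigma> i) (substitution \<sigma> i) \<and>
        (\<forall>R \<in> substitution \<sigma> i. \<exists>j \<alpha>. \<alpha> < 1 \<and> tile_of \<sigma> j \<alpha> R))"

definition normalized :: "'a::euclidean_space scheme \<Rightarrow> bool" where
  "normalized \<sigma> \<longleftrightarrow> (\<forall>i < num_types \<sigma>. vol (proto \<sigma> i) = 1)"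

definition geometrically_distinct :: "'a::euclidean_space scheme \<Rightarrow> bool" where
  "geometrically_distinct \<sigma> \<longleftrightarrow>
     (\<forall>i < num_types \<sigma>. \<forall>j < num_types \<sigma>. i \<noteq> j \<longrightarrow> \<not> has_type \<sigma> j (proto \<sigma> i))"

text \<open>The rescaled substitution rule applied to a tile \<open>Q = x + \<alpha> T\<^sub>j\<close>. For a normalized,
  geometrically distinct scheme the triple \<open>(j, \<alpha>, x)\<close> is determined by \<open>Q\<close>.\<close>

definition subst_tile :: "'a::euclidean_space scheme \<Rightarrow> 'a set \<Rightarrow> 'a set set" where
  "subst_tile \<sigma> Q = {homothet x \<alpha> R | x \<alpha> j R.
     j < num_types \<sigma> \<and> 0 < \<alpha> \<and> Q = homothet x \<alpha> (proto \<sigma> j) \<and> R \<in> substitution \<sigma> j}"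

definition subst_step :: "'a::euclidean_space scheme \<Rightarrow> 'a set set \<Rightarrow> 'a set set" where
  "subst_step \<sigma> P = {Q \<in> P. vol Q \<le> 1} \<union> (\<Union>Q \<in> {Q \<in> P. 1 < vol Q}. subst_tile \<sigma> Q)"

text \<open>\<open>flow \<sigma> t Q\<close> is $F_t(Q)$: start from the single tile $e^t Q$ (dilation about the origin) and
  substitute until all volumes are at most 1.\<close>

definition flow :: "'a::euclidean_space scheme \<Rightarrow> real \<Rightarrow> 'a set \<Rightarrow> 'a set set" where
  "flow \<sigma> t Q = (let P = (\<lambda>m. (subst_step \<sigma> ^^ m) {homothet 0 (exp t) Q})
                  in P (LEAST m. \<forall>R \<in> P m. vol R \<le> 1))"

definition irreducible_scheme :: "'a::euclidean_space scheme \<Rightarrow> bool" where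
  "irreducible_scheme \<sigma> \<longleftrightarrow> (\<forall>i < num_types \<sigma>. \<forall>j < num_types \<sigma>.
     \<exists>t>0. \<exists>Q \<in> flow \<sigma> t (proto \<sigma> i). has_type \<sigma> j Q)"

definition return_times :: "'a::euclidean_space scheme \<Rightarrow> nat \<Rightarrow> real set" where
  "return_times \<sigma> i =
     {t. 0 \<le> t \<and> (\<exists>Q \<in> flow \<sigma> t (proto \<sigma> i). has_type \<sigma> i Q \<and> vol Q = 1)}"

definition incommensurable :: "'a::euclidean_space scheme \<Rightarrow> bool" where
  "incommensurable \<sigma> \<longleftrightarrow> (\<exists>i < num_types \<sigma>. \<exists>j < num_types \<sigma>.
     \<exists>t\<^sub>1 \<in> return_times \<sigma> i. \<exists>t\<^sub>2 \<in> return_times \<sigma> j.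
       0 < t\<^sub>1 \<and> 0 < t\<^sub>2 \<and> \<not> (\<exists>q \<in> \<rat>. t\<^sub>1 = q * t\<^sub>2))"

abbreviation commensurable :: "'a::euclidean_space scheme \<Rightarrow> bool" where
  "commensurable \<sigma> \<equiv> \<not> incommensurable \<sigma>"

text \<open>The edges leaving \<open>i\<close> are in bijection with the tiles \<open>R\<close> of $\varrho_\sigma(T_i)$, hence with
  the entries of the list $\omega_\sigma(T_i)$; \<open>(i, R)\<close> and \<open>(i, R')\<close> are parallel edges if \<open>R\<close> and
  \<open>R'\<close> have the same type. The length of \<open>(i, R)\<close>, with \<open>R\<close> of scale \<open>\<alpha>\<close>, is $\log(1/\alpha)$; it is
  not recorded because the path of ancestors below is determined by its edges.\<close>

definition assoc_graph :: "'a::euclidean_space scheme \<Rightarrow> (nat, nat \<times> 'a set) pre_digraph" where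
  "assoc_graph \<sigma> = \<lparr>verts = {..<num_types \<sigma>},
     arcs = (SIGMA i:{..<num_types \<sigma>}. substitution \<sigma> i),
     tail = fst,
     head = (\<lambda>e. THE j. has_type \<sigma> j (snd e))\<rparr>"

text \<open>\<open>ancestry \<sigma> Q es R\<close>: the tile \<open>R\<close> arises from \<open>Q\<close> by successively substituting tiles of
  volume greater than 1, and \<open>es\<close> is the sequence of edges of the associated graph recorded by the
  chain of ancestors from \<open>Q\<close> down to \<open>R\<close>.\<close>

inductive ancestry ::
  "'a::euclidean_space scheme \<Rightarrow> 'a set \<Rightarrow> (nat \<times> 'a set) list \<Rightarrow> 'a set \<Rightarrow> bool"
  for \<sigma> where
  ancestry_Nil: "ancestry \<sigma> Q [] Q"
| ancestry_Cons: "\<lbrakk>i < num_types \<sigma>; 0 < \<alpha>; Q = homothet x \<alpha> (proto \<sigma> i); 1 < vol Q;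
    S \<in> substitution \<sigma> i; ancestry \<sigma> (homothet x \<alpha> S) es R\<rbrakk>
    \<Longrightarrow> ancestry \<sigma> Q ((i, S) # es) R"

definition neighborhood :: "real \<Rightarrow> 'a::euclidean_space set \<Rightarrow> 'a set" where
  "neighborhood r A = (\<Union>a\<in>A. ball a r)"

definition patch_dist :: "'a::euclidean_space set \<Rightarrow> 'a set \<Rightarrow> real" where
  "patch_dist A B = Inf ({r. 0 < r \<and> A \<inter> ball 0 (1 / r) \<subseteq> neighborhood r B \<and>
                              B \<inter> ball 0 (1 / r) \<subseteq> neighborhood r A} \<union> {1})"

definition boundary_set :: "'a::euclidean_space set set \<Rightarrow> 'a set" where
  "boundary_set P = (\<Union>Q\<in>P. frontier Q)"

definition generated_patches :: "'a::euclidean_space scheme \<Rightarrow> 'a set set set" where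
  "generated_patches \<sigma> = {flow \<sigma> t (proto \<sigma> i) | t i. 0 \<le> t \<and> i < num_types \<sigma>}"

definition tiling_space :: "'a::euclidean_space scheme \<Rightarrow> 'a set set set" where
  "tiling_space \<sigma> = {\<T>. tessellation UNIV \<T> \<and>
     (\<forall>P. subpatch P \<T> \<longrightarrow>
        (\<exists>p. (\<forall>m::nat. \<exists>P' \<in> generated_patches \<sigma>. \<exists>P''. \<exists>x.
                 subpatch P'' P' \<and> p m = translate x ` P'') \<and>
             (\<lambda>m. patch_dist (boundary_set (p m)) (boundary_set P)) \<longlonglongrightarrow> 0))}"

definition stationary_tiling ::
  "'a::euclidean_space scheme \<Rightarrow> real \<Rightarrow> 'a set set \<Rightarrow> bool" where
  "stationary_tiling \<sigma> s \<S> \<longleftrightarrow> \<S> \<in> tiling_space \<sigma> \<and>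
     (\<exists>i x a. i < num_types \<sigma> \<and> 0 < s \<and> s \<in> return_times \<sigma> i \<and> 0 \<le> a \<and>
        0 \<in> interior (translate x (proto \<sigma> i)) \<and>
        (\<forall>k::nat. subpatch (flow \<sigma> (a + real k * s) (translate x (proto \<sigma> i)))
                           (flow \<sigma> (a + real (Suc k) * s) (translate x (proto \<sigma> i)))) \<and>
        \<S> = (\<Union>k::nat. flow \<sigma> (a + real k * s) (translate x (proto \<sigma> i))))"

text \<open>The representation of a stationary tiling as the nested union of the patches $F_{ks}(T)$,
  where \<open>T\<close> is a single tile (of scale at most 1, as required for $F_t(T)$ to be defined). Nestedness
  for \<open>k = 0\<close> says that \<open>T\<close> itself is a tile of $F_s(T)$.\<close>

definition stationary_from ::
  "'a::euclidean_space scheme \<Rightarrow> real \<Rightarrow> 'a set \<Rightarrow> 'a set set \<Rightarrow> bool" where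
  "stationary_from \<sigma> s T \<S> \<longleftrightarrow> (\<exists>j \<alpha>. \<alpha> \<le> 1 \<and> tile_of \<sigma> j \<alpha> T) \<and>
     (\<forall>k::nat. subpatch (flow \<sigma> (real k * s) T) (flow \<sigma> (real (Suc k) * s) T)) \<and>
     \<S> = (\<Union>k::nat. flow \<sigma> (real k * s) T)"

text \<open>Minimality of \<open>s\<close>: the path recording the ancestors of the tile \<open>T\<close> of $F_s(T)$, from $e^s T$
  down to \<open>T\<close>, is not a concatenation of several copies of one closed path.\<close>

definition minimal_period :: "'a::euclidean_space scheme \<Rightarrow> real \<Rightarrow> 'a set \<Rightarrow> bool" where
  "minimal_period \<sigma> s T \<longleftrightarrow> (\<forall>es. ancestry \<sigma> (homothet 0 (exp s) T) es T \<longrightarrow>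
     \<not> (\<exists>i p m. 2 \<le> m \<and> pre_digraph.awalk (assoc_graph \<sigma>) i p i \<and>
            es = concat (replicate m p)))"

definition tile_complexity ::
  "'a::euclidean_space scheme \<Rightarrow> real \<Rightarrow> 'a set \<Rightarrow> nat \<Rightarrow> nat" where
  "tile_complexity \<sigma> s T k =
     card (flow \<sigma> (real k * s) T // {(Q, R). \<exists>x. R = translate x Q})"

end

theory Submission
  imports Defs
begin

text \<open>Up to translation, a tile is determined by its type \<open>j\<close> and its height \<open>h\<close>, the logarithm of
  its scale: the volume gives the scale, and geometrical distinctness then gives the type. Inflating
  by \<open>exp t\<close> raises heights by \<open>t\<close>; substituting a tile of type \<open>i\<close> moves it along the edges leaving
  \<open>i\<close> in the associated graph, each of which lowers the height by its length. The flow stops at the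
  first height \<open>\<le> 0\<close>. So the classes of tiles in \<open>flow \<sigma> t Q\<close> are the \<^emph>\<open>front\<close> reached from the
  class of \<open>Q\<close>, raised by \<open>t\<close> (lemma \<open>flow_front\<close>), and the theorem becomes a statement about a
  finite weighted graph.

  Fronts form a semi-flow (lemma \<open>front_add\<close>). Hence the set \<open>C (k + 1)\<close> of classes in $F_{(k+1)s}(T)$
  depends only on \<open>C k\<close>. Nestedness makes these finite sets increase with \<open>k\<close>, so once two
  consecutive ones have the same cardinality they are equal, and the sequence is constant from there
  on. Such a stabilisation happens if and only if \<open>\<Union>k. C k\<close> is finite.

  The return times are the lengths of the closed walks of the graph, and \<open>s\<close> is one of them.
  Commensurability therefore says that all these lengths are rational multiples of \<open>s\<close>.

  If that is so, then, edges being finite in number, the lengths of all walks from the type of \<open>T\<close>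
  to a given type lie in one coset of a discrete group that contains \<open>s\<close>. The heights occurring for
  each type then form a discrete bounded set, so there are finitely many classes
  (lemma \<open>rational_imp_finite\<close>).

  Conversely let there be finitely many classes, and let \<open>t\<close> be the length of a closed walk at \<open>v\<close>.
  Reach \<open>v\<close> by a walk of length \<open>p\<close>, run through the closed walk \<open>m\<close> times, and compare with the next
  multiple of \<open>s\<close>: the overshoot lies in \<open>[0, s]\<close>, and because it differs from the height of one of
  the finitely many classes by the length of a bounded walk, it takes only finitely many values. A
  coincidence for two values of \<open>m\<close> exhibits \<open>t\<close> as a rational multiple of \<open>s\<close>
  (lemma \<open>finite_imp_rational\<close>).\<close>

section \<open>Fronts in a weighted graph\<close>

text \<open>The graph abstracts the associated graph $G_\sigma$. Parallel edges of equal length are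
  identified, since only the lengths of walks matter for counting classes of tiles.\<close>

locale weighted_graph =
  fixes V :: "'v set" and E :: "('v \<times> real \<times> 'v) set"
  assumes finite_V: "finite V" and finite_E: "finite E"
    and E_V: "(i, l, j) \<in> E \<Longrightarrow> i \<in> V \<and> j \<in> V"
    and E_pos: "(i, l, j) \<in> E \<Longrightarrow> 0 < l"
begin

inductive walk :: "'v \<Rightarrow> real \<Rightarrow> 'v \<Rightarrow> bool" for i where
  walk_Nil: "walk i 0 i"
| walk_snoc: "walk i x j \<Longrightarrow> (j, l, k) \<in> E \<Longrightarrow> walk i (x + l) k"

text \<open>The pair \<open>(i, h)\<close> stands for the class of tiles of type \<open>i\<close> and scale \<open>exp h\<close>. A tile of scale
  exactly 1 is not substituted, whence the strict inequality.\<close>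

definition step :: "'v \<times> real \<Rightarrow> 'v \<times> real \<Rightarrow> bool" where
  "step c c' \<longleftrightarrow> 0 < snd c \<and> (fst c, snd c - snd c', fst c') \<in> E"

definition front :: "'v \<times> real \<Rightarrow> ('v \<times> real) set" where
  "front c = {c'. step\<^sup>*\<^sup>* c c' \<and> snd c' \<le> 0}"

lemma walk_nonneg: "walk i x j \<Longrightarrow> 0 \<le> x"
  by (induction rule: walk.induct) (auto dest: E_pos)

lemma walk_trans: "walk i x j \<Longrightarrow> walk j y k \<Longrightarrow> walk i (x + y) k"
proof (rotate_tac, induction rule: walk.induct)
  case (walk_snoc y k l m)
  then show ?case using walk.walk_snoc[of i "x + y" k l m] by (simp add: add.assoc)
qed simp

lemma walk_power: "walk i x i \<Longrightarrow> walk i (real m * x) i"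
proof (induction m)
  case (Suc m)
  then show ?case using walk_trans[of i "real m * x" i x i] by (simp add: algebra_simps)
qed (simp add: walk_Nil)

lemma walk_in_V: "walk i x j \<Longrightarrow> i \<in> V \<Longrightarrow> j \<in> V"
  by (induction rule: walk.induct) (auto dest: E_V)

lemma steps_imp_walk: "step\<^sup>*\<^sup>* c c' \<Longrightarrow> walk (fst c) (snd c - snd c') (fst c')"
proof (induction rule: rtranclp_induct)
  case (step c' c'')
  then show ?case
    using walk_snoc[of "fst c" "snd c - snd c'" "fst c'" "snd c' - snd c''" "fst c''"]
    by (simp add: step_def)
qed (simp add: walk_Nil)

text \<open>A walk that does not descend below height 0 has positive height before its last edge, because
  lengths are positive; so none of its edges is blocked by the stopping rule.\<close>

lemma walk_imp_steps: "walk i x j \<Longrightarrow> x \<le> h \<Longrightarrow> step\<^sup>*\<^sup>* (i, h) (j, h - x)"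
proof (induction rule: walk.induct)
  case (walk_snoc x j l k)
  from walk_snoc.hyps(2) have "0 < l" by (rule E_pos)
  with walk_snoc have "step\<^sup>*\<^sup>* (i, h) (j, h - x)" by simp
  moreover have "step (j, h - x) (k, h - (x + l))"
    using walk_snoc \<open>0 < l\<close> by (simp add: step_def)
  ultimately show ?case by (rule rtranclp.rtrancl_into_rtrancl)
qed simp

lemma front_zero_iff: "(j, 0) \<in> front (i, h) \<longleftrightarrow> walk i h j"
  using steps_imp_walk[of "(i, h)" "(j, 0)"] walk_imp_steps[of i h j h]
  by (auto simp: front_def)

lemma front_nonpos: "snd c \<le> 0 \<Longrightarrow> front c = {c}"
  by (auto simp: front_def step_def elim: converse_rtranclpE)

lemma front_steps: "step\<^sup>*\<^sup>* c c' \<Longrightarrow> front c' \<subseteq> front c"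
  by (auto simp: front_def)

lemma front_pos:
  assumes "0 < snd c"
  shows "front c = \<Union> (front ` {c'. step c c'})"
  using assms by (auto simp: front_def elim: converse_rtranclpE intro: converse_rtranclp_into_rtranclp)

lemma steps_raise:
  "step\<^sup>*\<^sup>* c c' \<Longrightarrow> 0 \<le> t \<Longrightarrow> step\<^sup>*\<^sup>* (fst c, snd c + t) (fst c', snd c' + t)"
proof (induction rule: rtranclp_induct)
  case (step c' c'')
  then have "step (fst c', snd c' + t) (fst c'', snd c'' + t)"
    by (auto simp: step_def)
  with step show ?case by (meson rtranclp.rtrancl_into_rtrancl)
qed simp

text \<open>The semi-flow property $F_{h+t} = F_t \circ F_h$. Seen from a height lower by \<open>t\<close>, every descent
  that ends at height \<open>\<le> 0\<close> first passes the stopping level; the class at that passage is the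
  intermediate one.\<close>

lemma front_add:
  assumes "0 \<le> t"
  shows "front (i, h + t) = (\<Union>(j, y) \<in> front (i, h). front (j, y + t))"
proof
  have "c' \<in> (\<Union>(j, y) \<in> front (fst c, snd c - t). front (j, y + t))"
    if "step\<^sup>*\<^sup>* c c'" "snd c' \<le> 0" for c c'
    using that
  proof (induction rule: converse_rtranclp_induct)
    case base
    then show ?case using assms by (auto simp: front_nonpos)
  next
    case (step c c1)
    show ?case
    proof (cases "snd c \<le> t")
      case True
      have "c' \<in> front c"
        using step unfolding front_def by (auto intro: converse_rtranclp_into_rtranclp)
      then show ?thesis using True by (simp add: front_nonpos)
    next
      case False
      then have "step (fst c, snd c - t) (fst c1, snd c1 - t)"
        using step by (simp add: step_def)
      then have "front (fst c1, snd c1 - t) \<subseteq> front (fst c, snd c - t)"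
        by (intro front_steps) auto
      with step show ?thesis by blast
    qed
  qed
  from this[of "(i, h + t)"]
  show "front (i, h + t) \<subseteq> (\<Union>(j, y) \<in> front (i, h). front (j, y + t))"
    by (auto simp: front_def)
  have "front (j, y + t) \<subseteq> front (i, h + t)" if "(j, y) \<in> front (i, h)" for j y
    using that steps_raise[of "(i, h)" "(j, y)" t] assms
    by (intro front_steps) (auto simp: front_def)
  then show "(\<Union>(j, y) \<in> front (i, h). front (j, y + t)) \<subseteq> front (i, h + t)"
    by auto
qed

lemma length_bounds:
  obtains \<epsilon> L where "0 < \<epsilon>" and "0 \<le> L" and "\<And>i l j. (i, l, j) \<in> E \<Longrightarrow> \<epsilon> \<le> l \<and> l \<le> L"
proof
  let ?A = "insert 1 ((\<lambda>(i, l, j). l) ` E)"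
  have "finite ?A" using finite_E by simp
  then show "0 < Min ?A" by (auto dest: E_pos)
  show "0 \<le> Max ?A" using \<open>finite ?A\<close> by (intro order.trans[OF _ Max_ge[of _ 1]]) auto
  show "Min ?A \<le> l \<and> l \<le> Max ?A" if "(i, l, j) \<in> E" for i l j
    using that \<open>finite ?A\<close> by (force intro: Min_le Max_ge)
qed

text \<open>Edge lengths are bounded away from 0, so a bound on the length of a walk bounds the number of its
  edges.\<close>

lemma finite_short_walks: "finite {(x, j). walk i x j \<and> x \<le> B}"
proof -
  obtain \<epsilon> L where \<epsilon>: "0 < \<epsilon>" "\<And>i l j. (i, l, j) \<in> E \<Longrightarrow> \<epsilon> \<le> l"
    using length_bounds by metis
  have "finite {(x, j). walk i x j \<and> x \<le> real n * \<epsilon>}" (is "finite (?W n)") for n :: nat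
  proof (induction n)
    case 0
    have "x = 0 \<and> k = i" if "walk i x k" "x \<le> 0" for x k
      using that(1) by cases (use that(2) in \<open>force dest: walk_nonneg E_pos\<close>)+
    then have "?W 0 \<subseteq> {(0, i)}" by auto
    then show ?case by (rule finite_subset) simp
  next
    case (Suc n)
    have "?W (Suc n) \<subseteq> insert (0, i) ((\<lambda>((x, j), (j', l, k)). (x + l, k)) ` (?W n \<times> E))"
      (is "_ \<subseteq> ?R")
    proof (rule subsetI, elim CollectE case_prodE conjE)
      fix c x k assume c: "c = (x, k)" and k: "walk i x k" "x \<le> real (Suc n) * \<epsilon>"
      from k(1) show "c \<in> ?R"
      proof cases
        case (walk_snoc x' j l)
        then have "(x', j) \<in> ?W n" using k(2) \<epsilon>(2)[of j l k] by (simp add: algebra_simps)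
        with walk_snoc have "((x', j), (j, l, k)) \<in> ?W n \<times> E" by blast
        with walk_snoc(1) c show ?thesis by (intro insertI2 image_eqI) auto
      qed (simp add: c)
    qed
    then show ?case
      by (rule finite_subset) (use Suc finite_E in simp)
  qed
  note finite_W = this
  obtain n :: nat where "B \<le> real n * \<epsilon>"
    using \<epsilon>(1) by (metis order.strict_implies_order reals_Archimedean3)
  then have "{(x, j). walk i x j \<and> x \<le> B} \<subseteq> {(x, j). walk i x j \<and> x \<le> real n * \<epsilon>}"
    by auto
  then show ?thesis using finite_W by (rule finite_subset)
qed

text \<open>The last edge of a descent starts above height 0, so it ends at most the maximal edge length
  below 0; a descent without edges stays where it started.\<close>

lemma front_depth:
  obtains L where "0 \<le> L" and "\<And>c c'. c' \<in> front c \<Longrightarrow> min (snd c) (- L) \<le> snd c'"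
proof -
  obtain \<epsilon> L where L: "0 \<le> L" "\<And>i l j. (i, l, j) \<in> E \<Longrightarrow> l \<le> L"
    using length_bounds by metis
  have "min (snd c) (- L) \<le> snd c'" if "step\<^sup>*\<^sup>* c c'" for c c'
    using that
    by (induction rule: rtranclp_induct) (fastforce simp: step_def dest: L(2))+
  then show thesis using that L(1) unfolding front_def by blast
qed

lemma finite_front: "finite (front (i, h))"
proof -
  obtain L where L: "\<And>c c'. c' \<in> front c \<Longrightarrow> min (snd c) (- L) \<le> snd c'"
    using front_depth by metis
  have "front (i, h) \<subseteq> (\<lambda>(x, j). (j, h - x)) ` {(x, j). walk i x j \<and> x \<le> max 0 (h + L)}"
  proof safe
    fix j y assume *: "(j, y) \<in> front (i, h)"
    have "walk i (h - y) j" using * steps_imp_walk by (fastforce simp: front_def)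
    moreover have "h - y \<le> max 0 (h + L)" using L[OF *] by auto
    ultimately show "(j, y) \<in> (\<lambda>(x, j). (j, h - x)) ` {(x, j). walk i x j \<and> x \<le> max 0 (h + L)}"
      by (intro image_eqI[of _ _ "(h - y, j)"]) auto
  qed
  then show ?thesis by (rule finite_subset) (intro finite_imageI finite_short_walks)
qed

subsection \<open>Synchronous substitution\<close>

text \<open>The flow substitutes all large tiles of a patch at once; \<open>advance\<close> is the effect of one such round
  on classes. The set of classes that will eventually be reached is invariant under it, so that it can
  be read off as soon as no large tile is left.\<close>

definition advance :: "('v \<times> real) set \<Rightarrow> ('v \<times> real) set" where
  "advance X = {c \<in> X. snd c \<le> 0} \<union> {c'. \<exists>c \<in> X. step c c'}"

lemma front_advance: "\<Union> (front ` advance X) = \<Union> (front ` X)"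
proof
  show "\<Union> (front ` advance X) \<subseteq> \<Union> (front ` X)"
    unfolding advance_def using front_steps by blast
  show "\<Union> (front ` X) \<subseteq> \<Union> (front ` advance X)"
  proof safe
    fix c d x assume *: "(d, x) \<in> front c" "c \<in> X"
    show "(d, x) \<in> \<Union> (front ` advance X)"
    proof (cases "0 < snd c")
      case True
      then obtain c' where "step c c'" "(d, x) \<in> front c'" using * front_pos by auto
      then show ?thesis using * unfolding advance_def by blast
    next
      case False
      then have "c \<in> advance X" using * by (simp add: advance_def)
      then show ?thesis using * by blast
    qed
  qed
qed

lemma advance_eq_front:
  assumes "\<forall>c \<in> (advance ^^ m) {c0}. snd c \<le> 0"
  shows "(advance ^^ m) {c0} = front c0"
proof -
  have "\<Union> (front ` (advance ^^ m) {c0}) = front c0"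
    by (induction m) (simp_all add: front_advance)
  moreover have "\<Union> (front ` (advance ^^ m) {c0}) = (advance ^^ m) {c0}"
    using assms by (simp add: front_nonpos)
  ultimately show ?thesis by simp
qed

lemma advance_terminates: "\<exists>m. \<forall>c \<in> (advance ^^ m) {c0}. snd c \<le> 0"
proof -
  obtain \<epsilon> L where \<epsilon>: "0 < \<epsilon>" "\<And>i l j. (i, l, j) \<in> E \<Longrightarrow> \<epsilon> \<le> l"
    using length_bounds by metis
  have bound: "snd c \<le> max 0 (snd c0 - real m * \<epsilon>)" if "c \<in> (advance ^^ m) {c0}" for c m
    using that
  proof (induction m arbitrary: c)
    case (Suc m)
    then consider "snd c \<le> 0" | c' where "c' \<in> (advance ^^ m) {c0}" "step c' c"
      unfolding funpow.simps(2) o_apply advance_def[of "(advance ^^ m) {c0}"] by blast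
    then show ?case
    proof cases
      case 2
      then show ?thesis
        using Suc.IH[of c'] \<epsilon>(2)[of "fst c'" "snd c' - snd c" "fst c"]
        by (auto simp: step_def algebra_simps)
    qed simp
  qed simp
  obtain m where "snd c0 < real m * \<epsilon>" using \<epsilon>(1) reals_Archimedean3 by blast
  then have "\<forall>c \<in> (advance ^^ m) {c0}. snd c \<le> 0" using bound[of _ m] by fastforce
  then show ?thesis ..
qed

end

section \<open>Nested fronts\<close>

lemma common_denominator:
  assumes "finite A" and "A \<subseteq> (\<rat> :: real set)"
  shows "\<exists>N::nat. 0 < N \<and> (\<forall>a\<in>A. real N * a \<in> \<int>)"
  using assms
proof (induction rule: finite_induct)
  case empty
  then show ?case by auto
next
  case (insert a A)
  then obtain N where N: "0 < N" "\<forall>a\<in>A. real N * a \<in> \<int>" by auto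
  have "a \<in> \<rat>" using insert by simp
  then obtain m n where n: "n \<noteq> 0" "\<bar>a\<bar> = real m / real n"
    by (rule Rats_abs_nat_div_natE) 
  then have "\<bar>real n * a\<bar> = real m" by (simp add: abs_mult)
  then have "real n * a = real m \<or> real n * a = - real m" by linarith
  then have "real n * a \<in> \<int>" by (auto simp only: Ints_minus Ints_of_nat)
  then have "real (N * n) * a \<in> \<int>"
    using Ints_mult[of "of_nat N" "real n * a"] by (simp add: mult.assoc)
  moreover have "real (N * n) * b \<in> \<int>" if "b \<in> A" for b
    using that N(2) Ints_mult[of "of_nat n" "real N * b"] by (simp add: mult_ac)
  ultimately show ?case using N(1) n(1) by (intro exI[of _ "N * n"]) auto
qed

text \<open>The situation of a stationary tiling: \<open>(r, h)\<close> is the class of \<open>T\<close>, and \<open>nested\<close> is what remains of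
  the nestedness of the patches $F_{ks}(T)$ when tiles are replaced by their classes.\<close>

locale nested_fronts = weighted_graph V E
  for V :: "'v set" and E :: "('v \<times> real \<times> 'v) set" +
  fixes r :: 'v and h s :: real
  assumes r: "r \<in> V" and h: "h \<le> 0" and s: "0 < s"
    and connected: "i \<in> V \<Longrightarrow> j \<in> V \<Longrightarrow> \<exists>x. walk i x j"
    and nested: "front (r, h + real k * s) \<subseteq> front (r, h + real (Suc k) * s)"
begin

definition classes :: "nat \<Rightarrow> ('v \<times> real) set" where
  "classes k = front (r, h + real k * s)"

lemma finite_classes: "finite (classes k)"
  unfolding classes_def by (rule finite_front)

lemma classes_mono: "k \<le> k' \<Longrightarrow> classes k \<subseteq> classes k'"
  using lift_Suc_mono_le[of classes] nested unfolding classes_def by blast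

lemma classes_Suc: "classes (Suc k) = (\<Union>(j, y) \<in> classes k. front (j, y + s))"
  using front_add[of s r "h + real k * s"] s
  unfolding classes_def by (simp add: algebra_simps)

lemma classes_stabilise:
  assumes "card (classes (Suc l)) = card (classes l)" and "l \<le> k"
  shows "classes k = classes l"
proof -
  have *: "classes (Suc l) = classes l"
    using card_subset_eq[OF finite_classes classes_mono[of l "Suc l"]] assms by simp
  from assms(2) show ?thesis
    by (induction rule: dec_induct) (simp_all add: classes_Suc * [unfolded classes_Suc])
qed

text \<open>The class of \<open>T\<close> recurs in the patch $F_s(T)$, and the descent leading to it has length \<open>s\<close>.\<close>

lemma closed_walk_s: "walk r s r"
proof -
  have "(r, h) \<in> classes 0" using h by (simp add: classes_def front_nonpos)
  then have "(r, h) \<in> classes 1" using classes_mono[of 0 1] by auto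
  then show ?thesis
    using steps_imp_walk[of "(r, h + s)" "(r, h)"] by (simp add: classes_def front_def)
qed

text \<open>Choose for each vertex \<open>v\<close> the length \<open>p v\<close> of some walk from \<open>r\<close>. Up to this potential, the length
  \<open>p u + l - p w\<close> of an edge \<open>(u, l, w)\<close> is the difference of the lengths of two closed walks at \<open>r\<close>,
  hence a rational multiple of \<open>s\<close>. A common denominator for the finitely many edges gives a
  \<open>\<delta>\<close> such that all walks from \<open>r\<close> to \<open>j\<close> have lengths in \<open>p j - p r + \<delta>\<int>\<close>, and \<open>s\<close> is itself a
  multiple of \<open>\<delta>\<close>.\<close>

lemma rational_imp_finite:
  assumes rat: "\<And>x. walk r x r \<Longrightarrow> x / s \<in> \<rat>"
  shows "finite (\<Union>k. classes k)"
proof -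
  obtain p where p: "\<And>v. v \<in> V \<Longrightarrow> walk r (p v) v" using connected[OF r] by metis
  define g where "g = (\<lambda>(u, l, w). (p u + l - p w) / s)"
  have g_rat: "g ` E \<subseteq> \<rat>"
  proof safe
    fix u l w assume e: "(u, l, w) \<in> E"
    then have uw: "u \<in> V" "w \<in> V" using E_V by auto
    then obtain q where q: "walk w q r" using connected r by blast
    have "walk r ((p u + l) + q) r" "walk r (p w + q) r"
      using walk_trans walk_snoc p uw e q by blast+
    then have "((p u + l) + q) / s - (p w + q) / s \<in> \<rat>" using rat by (intro Rats_diff)
    then show "g (u, l, w) \<in> \<rat>" by (simp add: g_def diff_divide_distrib[symmetric])
  qed
  obtain N :: nat where N: "0 < N" "\<forall>a \<in> g ` E. real N * a \<in> \<int>"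
    using common_denominator[OF finite_imageI[OF finite_E] g_rat] by blast
  define \<delta> where "\<delta> = s / real N"
  have \<delta>: "0 < \<delta>" using s N by (simp add: \<delta>_def)
  have s_\<delta>: "s = real N * \<delta>" using N by (simp add: \<delta>_def)
  have coset: "(x - p j + p r) / \<delta> \<in> \<int>" if "walk r x j" for x j
    using that
  proof (induction rule: walk.induct)
    case (walk_snoc x j l k)
    have "real N * g (j, l, k) \<in> \<int>" using N walk_snoc by blast
    then have "(p j + l - p k) / \<delta> \<in> \<int>" by (simp add: g_def \<delta>_def mult.commute)
    with walk_snoc.IH have "(x - p j + p r) / \<delta> + (p j + l - p k) / \<delta> \<in> \<int>" by (rule Ints_add)
    then show ?case by (simp add: add_divide_distrib[symmetric] algebra_simps)
  qed simp
  obtain L where L: "\<And>c c'. c' \<in> front c \<Longrightarrow> min (snd c) (- L) \<le> snd c'"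
    using front_depth by metis
  define M where "M = min h (- L)"
  define Y where "Y j = {y. M \<le> y \<and> y \<le> 0 \<and> (h + p r - p j - y) / \<delta> \<in> \<int>}" for j
  have "finite (Y j)" for j
  proof -
    let ?f = "\<lambda>n::int. h + p r - p j - \<delta> * of_int n"
    let ?Z = "{\<lfloor>(h + p r - p j) / \<delta>\<rfloor>..\<lceil>(h + p r - p j - M) / \<delta>\<rceil>}"
    have "Y j \<subseteq> ?f ` ?Z"
    proof
      fix y assume y: "y \<in> Y j"
      then obtain n where n: "(h + p r - p j - y) / \<delta> = of_int n"
        by (auto simp: Y_def elim: Ints_cases)
      then have "h + p r - p j - y = \<delta> * of_int n" using \<delta> by (simp add: field_simps)
      then have yn: "y = ?f n" by simp
      have "(h + p r - p j) / \<delta> \<le> (h + p r - p j - y) / \<delta>"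
        "(h + p r - p j - y) / \<delta> \<le> (h + p r - p j - M) / \<delta>"
        using y \<delta> by (auto simp: Y_def intro!: divide_right_mono)
      then have "n \<in> ?Z" unfolding n by (simp add: floor_le_iff le_ceiling_iff)
      with yn show "y \<in> ?f ` ?Z" by blast
    qed
    then show ?thesis by (rule finite_subset) simp
  qed
  then have "finite (SIGMA j:V. Y j)" using finite_V by simp
  moreover have "(\<Union>k. classes k) \<subseteq> (SIGMA j:V. Y j)"
  proof safe
    fix k j y assume jy: "(j, y) \<in> classes k"
    then have w: "walk r (h + real k * s - y) j" and "y \<le> 0"
      using steps_imp_walk by (fastforce simp: classes_def front_def)+
    then show "j \<in> V" using walk_in_V r by blast
    have "h \<le> h + real k * s" using s by simp
    then have "M \<le> y" using L[of "(j, y)" "(r, h + real k * s)"] jy by (auto simp: classes_def M_def)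
    \<comment> \<open>\<open>s = N \<delta>\<close>, so \<open>k s\<close> can be dropped modulo \<open>\<delta>\<close>: the coset of \<open>y\<close> does not depend on \<open>k\<close>.\<close>
    have "(h + real k * s - y - p j + p r) / \<delta> - of_nat (k * N) \<in> \<int>"
      using coset[OF w] by (intro Ints_diff) auto
    moreover have "(h + real k * s - y - p j + p r) / \<delta> - of_nat (k * N)
        = (h + p r - p j - y) / \<delta>"
      using \<delta> unfolding s_\<delta> by (simp add: field_simps)
    ultimately have "(h + p r - p j - y) / \<delta> \<in> \<int>" by (simp only:)
    then show "y \<in> Y j" using \<open>M \<le> y\<close> \<open>y \<le> 0\<close> by (simp add: Y_def)
  qed
  ultimately show ?thesis by (rule finite_subset[rotated])
qed

lemma finite_imp_stable:
  assumes "finite (\<Union>k. classes k)"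
  shows "\<exists>l. card (classes (Suc l)) = card (classes l)"
proof (rule ccontr)
  assume "\<not> ?thesis"
  then have lt: "card (classes l) < card (classes (Suc l))" for l
    using card_mono[OF finite_classes classes_mono[of l "Suc l"]] by (metis le_neq_implies_less le_SucI order_refl)
  have "k \<le> card (classes k)" for k
    by (induction k) (use lt in \<open>auto intro: le_less_trans Suc_leI\<close>)
  moreover have "card (classes k) \<le> card (\<Union>k. classes k)" for k
    using assms by (intro card_mono) auto
  ultimately show False by (meson le_trans not_less_eq_eq)
qed

text \<open>The pigeonhole argument. Here \<open>k m\<close> is the first time, in units of \<open>s\<close>, at which \<open>m\<close> rounds of the
  closed walk at \<open>v\<close> can be completed without stopping, and \<open>\<rho> m\<close> is the height at which they end.\<close>

lemma finite_imp_rational: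
  assumes fin: "finite (\<Union>k. classes k)" and v: "v \<in> V" and t: "0 < t" "walk v t v"
  shows "t / s \<in> \<rat>"
proof -
  let ?F = "\<Union>k. classes k"
  obtain p where p: "walk r p v" using connected r v by blast
  define k where "k m = nat \<lceil>(p + real m * t - h) / s\<rceil>" for m :: nat
  define \<rho> where "\<rho> m = h + real (k m) * s - (p + real m * t)" for m
  have \<rho>: "0 \<le> \<rho> m" "\<rho> m \<le> s" for m
  proof -
    let ?z = "(p + real m * t - h) / s"
    have "0 \<le> real m * t" using t by simp
    then have "0 \<le> ?z" using walk_nonneg[OF p] h s by (intro divide_nonneg_pos) linarith+
    then have "real (k m) = of_int \<lceil>?z\<rceil>" by (simp add: k_def)
    then have "?z \<le> real (k m)" "real (k m) \<le> ?z + 1" by linarith+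
    then show "0 \<le> \<rho> m" "\<rho> m \<le> s"
      using s by (simp_all add: \<rho>_def field_simps)
  qed
  have front_F: "front (v, \<rho> m) \<subseteq> ?F" for m
  proof -
    have "walk r (p + real m * t) v" using walk_trans[OF p walk_power[OF t(2)]] .
    then have "step\<^sup>*\<^sup>* (r, h + real (k m) * s) (v, \<rho> m)"
      using walk_imp_steps[of r "p + real m * t" v "h + real (k m) * s"] \<rho>(1)[of m]
      by (simp add: \<rho>_def)
    then show ?thesis using front_steps unfolding classes_def by blast
  qed
  \<comment> \<open>A dead end would make a front empty; repeating the closed walk often enough rules this out.\<close>
  obtain n :: nat where n: "s \<le> real n * t"
    using t(1) by (metis order.strict_implies_order reals_Archimedean3)
  have nonempty: "front (v, \<rho> m) \<noteq> {}" for m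
  proof -
    have "(v, 0) \<in> front (v, \<rho> m + (real n * t - \<rho> m))"
      using walk_power[OF t(2)] by (simp add: front_zero_iff)
    then show ?thesis using front_add[of "real n * t - \<rho> m" v "\<rho> m"] \<rho>(2)[of m] n by auto
  qed
  obtain L where L: "0 \<le> L" "\<And>c c'. c' \<in> front c \<Longrightarrow> min (snd c) (- L) \<le> snd c'"
    using front_depth by metis
  let ?W = "{(x, j). walk v x j \<and> x \<le> s + L}"
  have "range \<rho> \<subseteq> (\<lambda>((x, j), (j', y)). x + y) ` (?W \<times> ?F)"
  proof safe
    fix m
    obtain j y where jy: "(j, y) \<in> front (v, \<rho> m)" using nonempty[of m] by auto
    have "walk v (\<rho> m - y) j" using jy steps_imp_walk by (fastforce simp: front_def)
    moreover have "\<rho> m - y \<le> s + L" using L(1) L(2)[OF jy] \<rho>[of m] by auto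
    moreover have "(j, y) \<in> ?F" using jy front_F by blast
    ultimately show "\<rho> m \<in> (\<lambda>((x, j), (j', y)). x + y) ` (?W \<times> ?F)"
      by (intro image_eqI[of _ _ "((\<rho> m - y, j), (j, y))"]) auto
  qed
  then have "finite (range \<rho>)"
    by (rule finite_subset) (intro finite_imageI finite_cartesian_product finite_short_walks fin)
  then have "\<not> inj \<rho>" using finite_imageD by blast
  then obtain m m' where m: "m \<noteq> m'" "\<rho> m = \<rho> m'" unfolding inj_def by blast
  then have "(real m - real m') * t = (real (k m) - real (k m')) * s"
    by (simp add: \<rho>_def algebra_simps)
  then have "t / s = (real (k m) - real (k m')) / (real m - real m')"
    using m(1) s by (simp add: field_simps)
  then show ?thesis by simp
qed

end

section \<open>From tiles to classes\<close>

lemma homothet_homothet: "homothet x \<alpha> (homothet y \<beta> A) = homothet (x + \<alpha> *\<^sub>R y) (\<alpha> * \<beta>) A"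
  by (auto simp: homothet_def image_image algebra_simps)

lemma homothet_id: "homothet 0 1 A = A"
  by (simp add: homothet_def)

lemma translate_homothet: "translate x A = homothet x 1 A"
  by (simp add: translate_def homothet_def)

lemma vol_homothet: "0 < \<alpha> \<Longrightarrow> vol (homothet x \<alpha> A) = \<alpha> ^ DIM('a) * vol A"
  for A :: "'a::euclidean_space set"
  using measure_lebesgue_affine[of \<alpha> x A] by (simp add: homothet_def add.commute)

lemma tile_of_homothet:
  assumes "0 < \<alpha>" and "tile_of \<sigma> j \<beta> Q"
  shows "tile_of \<sigma> j (\<alpha> * \<beta>) (homothet x \<alpha> Q)"
  using assms by (auto simp: tile_of_def homothet_homothet)

lemma tile_of_homothet_iff:
  assumes "0 < \<alpha>"
  shows "tile_of \<sigma> j \<beta> (homothet x \<alpha> Q) \<longleftrightarrow> tile_of \<sigma> j (\<beta> / \<alpha>) Q"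
proof
  have inv: "homothet (- (1 / \<alpha>) *\<^sub>R x) (1 / \<alpha>) (homothet x \<alpha> Q) = Q"
    using assms by (simp add: homothet_homothet homothet_id)
  assume "tile_of \<sigma> j \<beta> (homothet x \<alpha> Q)"
  then show "tile_of \<sigma> j (\<beta> / \<alpha>) Q"
    using tile_of_homothet[of "1 / \<alpha>" \<sigma> j \<beta> "homothet x \<alpha> Q" "- (1 / \<alpha>) *\<^sub>R x"] assms inv
    by simp
next
  assume "tile_of \<sigma> j (\<beta> / \<alpha>) Q"
  then show "tile_of \<sigma> j \<beta> (homothet x \<alpha> Q)"
    using tile_of_homothet[of \<alpha> \<sigma> j "\<beta> / \<alpha>" Q x] assms by simp
qed

text \<open>The associated graph in height coordinates: a tile of scale \<open>exp (- l)\<close> in the substitution of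
  \<open>T\<^sub>i\<close> is an edge of length \<open>l\<close>.\<close>

definition graph_edges :: "'a::euclidean_space scheme \<Rightarrow> (nat \<times> real \<times> nat) set" where
  "graph_edges \<sigma> =
     {(i, l, j). i < num_types \<sigma> \<and> (\<exists>R \<in> substitution \<sigma> i. tile_of \<sigma> j (exp (- l)) R)}"

definition tile_classes :: "'a::euclidean_space scheme \<Rightarrow> 'a set set \<Rightarrow> (nat \<times> real) set" where
  "tile_classes \<sigma> P = {(j, h). \<exists>Q \<in> P. tile_of \<sigma> j (exp h) Q}"

locale multiscale_scheme =
  fixes \<sigma> :: "'a::euclidean_space scheme"
  assumes scheme: "substitution_scheme \<sigma>"
    and normalized: "normalized \<sigma>"
    and distinct: "geometrically_distinct \<sigma>"
begin

lemma vol_tile_of: "tile_of \<sigma> j \<alpha> Q \<Longrightarrow> vol Q = \<alpha> ^ DIM('a)"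
  using normalized by (auto simp: tile_of_def normalized_def vol_homothet)

text \<open>Normalization is what makes the scale visible in the volume. Once the scales agree, a tile of two
  types would make one prototile a copy of another.\<close>

lemma tile_of_unique:
  assumes "tile_of \<sigma> i \<alpha> Q" and "tile_of \<sigma> j \<beta> Q"
  shows "i = j \<and> \<alpha> = \<beta>"
proof -
  have pos: "0 < \<alpha>" "0 < \<beta>" using assms by (auto simp: tile_of_def)
  have "\<alpha> ^ DIM('a) = \<beta> ^ DIM('a)" using assms vol_tile_of by metis
  then have "\<alpha> = \<beta>" using pos power_eq_iff_eq_base[of "DIM('a)" \<alpha> \<beta>] by simp
  moreover have "i = j"
  proof (rule ccontr)
    assume "i \<noteq> j"
    obtain x where "Q = homothet x \<alpha> (proto \<sigma> i)" using assms by (auto simp: tile_of_def)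
    then have "has_type \<sigma> j (proto \<sigma> i)"
      using assms(2) pos tile_of_homothet_iff unfolding has_type_def by blast
    with \<open>i \<noteq> j\<close> show False
      using assms distinct by (auto simp: geometrically_distinct_def tile_of_def)
  qed
  ultimately show ?thesis by simp
qed

lemma vol_le_1_iff: "tile_of \<sigma> j (exp h) Q \<Longrightarrow> vol Q \<le> 1 \<longleftrightarrow> h \<le> 0"
  using power_le_one_iff[of "exp h" "DIM('a)"] by (simp add: vol_tile_of)

lemma vol_eq_1_iff: "tile_of \<sigma> j (exp h) Q \<Longrightarrow> vol Q = 1 \<longleftrightarrow> h = 0"
  using power_eq_iff_eq_base[of "DIM('a)" "exp h" 1] by (simp add: vol_tile_of)

lemma has_type_exp: "has_type \<sigma> j Q \<longleftrightarrow> (\<exists>h. tile_of \<sigma> j (exp h) Q)"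
proof
  assume "has_type \<sigma> j Q"
  then obtain \<alpha> where "tile_of \<sigma> j \<alpha> Q" by (auto simp: has_type_def)
  moreover from this have "\<alpha> = exp (ln \<alpha>)" by (simp add: tile_of_def)
  ultimately show "\<exists>h. tile_of \<sigma> j (exp h) Q" by metis
qed (auto simp: has_type_def)

lemma tile_of_proto: "i < num_types \<sigma> \<Longrightarrow> tile_of \<sigma> i 1 (proto \<sigma> i)"
  unfolding tile_of_def by (metis homothet_id zero_less_one)

lemma substitution_typed:
  assumes "i < num_types \<sigma>" and "R \<in> substitution \<sigma> i"
  obtains j where "has_type \<sigma> j R"
  using assms scheme unfolding substitution_scheme_def has_type_def by blast

sublocale weighted_graph "{..<num_types \<sigma>}" "graph_edges \<sigma>"
proof
  have "finite {(i, l, j). tile_of \<sigma> j (exp (- l)) R \<and> i = k}" (is "finite ?A") for R k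
  proof -
    have "c = c'" if "c \<in> ?A" "c' \<in> ?A" for c c'
      using that by (auto dest: tile_of_unique)
    then have "?A = {} \<or> (\<exists>c. ?A = {c})" by blast
    then show ?thesis by (metis finite.emptyI finite_insert)
  qed
  moreover have "finite (substitution \<sigma> i)" if "i < num_types \<sigma>" for i
    using scheme that by (auto simp: substitution_scheme_def)
  ultimately have "finite (\<Union>k<num_types \<sigma>. \<Union>R\<in>substitution \<sigma> k.
      {(i, l, j). tile_of \<sigma> j (exp (- l)) R \<and> i = k})" by (intro finite_UN_I) auto
  then show "finite (graph_edges \<sigma>)"
    by (rule finite_subset[rotated]) (auto simp: graph_edges_def)
next
  fix i l j assume e: "(i, l, j) \<in> graph_edges \<sigma>"
  then show "i \<in> {..<num_types \<sigma>} \<and> j \<in> {..<num_types \<sigma>}"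
    by (auto simp: graph_edges_def tile_of_def)
  obtain R where R: "i < num_types \<sigma>" "R \<in> substitution \<sigma> i" "tile_of \<sigma> j (exp (- l)) R"
    using e by (auto simp: graph_edges_def)
  then obtain j' \<alpha> where "\<alpha> < 1" "tile_of \<sigma> j' \<alpha> R"
    using scheme unfolding substitution_scheme_def by blast
  with R have "exp (- l) < 1" using tile_of_unique by blast
  then show "0 < l" by simp
qed simp

lemma subst_tile_homothet:
  assumes "i < num_types \<sigma>" and "0 < \<alpha>" and "Q = homothet x \<alpha> (proto \<sigma> i)" and "R \<in> substitution \<sigma> i"
  shows "homothet x \<alpha> R \<in> subst_tile \<sigma> Q"
  using assms unfolding subst_tile_def by blast

lemma subst_tile_cases:
  assumes "tile_of \<sigma> i \<alpha> Q" and "S \<in> subst_tile \<sigma> Q"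
  obtains x R where "S = homothet x \<alpha> R" and "R \<in> substitution \<sigma> i" and "i < num_types \<sigma>" and "0 < \<alpha>"
proof -
  obtain x \<beta> j R where S: "S = homothet x \<beta> R" "j < num_types \<sigma>" "0 < \<beta>"
      "Q = homothet x \<beta> (proto \<sigma> j)" "R \<in> substitution \<sigma> j"
    using assms(2) unfolding subst_tile_def by blast
  then have "tile_of \<sigma> j \<beta> Q" by (auto simp: tile_of_def)
  with assms(1) have "j = i \<and> \<beta> = \<alpha>" using tile_of_unique by blast
  with S that[of x R] show thesis by simp
qed

text \<open>The set \<open>subst_tile \<sigma> Q\<close> ranges over all positions of a prototile that produce \<open>Q\<close>. They agree in
  type and scale, so each of them contributes the same classes.\<close>

lemma tile_classes_subst_tile:
  assumes Q: "tile_of \<sigma> i (exp h) Q"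
  shows "(j, h') \<in> tile_classes \<sigma> (subst_tile \<sigma> Q) \<longleftrightarrow> (i, h - h', j) \<in> graph_edges \<sigma>"
proof
  assume "(j, h') \<in> tile_classes \<sigma> (subst_tile \<sigma> Q)"
  then obtain S where S: "S \<in> subst_tile \<sigma> Q" "tile_of \<sigma> j (exp h') S"
    by (auto simp: tile_classes_def)
  from Q S(1) obtain x R where "S = homothet x (exp h) R" "R \<in> substitution \<sigma> i" "i < num_types \<sigma>"
    by (rule subst_tile_cases)
  with S(2) show "(i, h - h', j) \<in> graph_edges \<sigma>"
    by (auto simp: graph_edges_def tile_of_homothet_iff exp_diff)
next
  assume "(i, h - h', j) \<in> graph_edges \<sigma>"
  then obtain R where R: "i < num_types \<sigma>" "R \<in> substitution \<sigma> i" "tile_of \<sigma> j (exp (h' - h)) R"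
    by (auto simp: graph_edges_def)
  obtain x where "Q = homothet x (exp h) (proto \<sigma> i)" using Q by (auto simp: tile_of_def)
  with R have "homothet x (exp h) R \<in> subst_tile \<sigma> Q"
    by (intro subst_tile_homothet) auto
  moreover have "tile_of \<sigma> j (exp h') (homothet x (exp h) R)"
    using R(3) by (simp add: tile_of_homothet_iff exp_diff)
  ultimately show "(j, h') \<in> tile_classes \<sigma> (subst_tile \<sigma> Q)"
    unfolding tile_classes_def by blast
qed

text \<open>Every tile of the patch has a class, so that volumes and translation classes can be read off
  from \<open>tile_classes\<close>.\<close>

definition typed :: "'a set set \<Rightarrow> bool" where
  "typed P \<longleftrightarrow> (\<forall>Q \<in> P. \<exists>j h. tile_of \<sigma> j (exp h) Q)"

lemma typed_subst_step:
  assumes "typed P"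
  shows "typed (subst_step \<sigma> P)"
  unfolding typed_def
proof
  fix S assume "S \<in> subst_step \<sigma> P"
  then consider "S \<in> P" | Q where "Q \<in> P" "S \<in> subst_tile \<sigma> Q"
    unfolding subst_step_def by blast
  then show "\<exists>j h. tile_of \<sigma> j (exp h) S"
  proof cases
    case 1
    then show ?thesis using assms by (simp add: typed_def)
  next
    case 2
    then obtain i h where "tile_of \<sigma> i (exp h) Q" using assms by (auto simp: typed_def)
    then obtain x R where R: "S = homothet x (exp h) R" "R \<in> substitution \<sigma> i" "i < num_types \<sigma>"
      using 2(2) by (rule subst_tile_cases)
    then obtain j l where "tile_of \<sigma> j (exp l) R" using substitution_typed has_type_exp by metis
    then show ?thesis using tile_of_homothet[of "exp h" \<sigma> j "exp l" R x] R(1)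
      by (auto simp: exp_add[symmetric])
  qed
qed

lemma tile_classes_subst_step:
  assumes "typed P"
  shows "tile_classes \<sigma> (subst_step \<sigma> P) = advance (tile_classes \<sigma> P)" (is "?L = ?R")
proof (rule set_eqI, safe)
  fix j h' assume "(j, h') \<in> ?L"
  then obtain S where S: "S \<in> subst_step \<sigma> P" "tile_of \<sigma> j (exp h') S"
    by (auto simp: tile_classes_def)
  from S(1) consider "S \<in> P" "vol S \<le> 1" | Q where "Q \<in> P" "1 < vol Q" "S \<in> subst_tile \<sigma> Q"
    unfolding subst_step_def by blast
  then show "(j, h') \<in> ?R"
  proof cases
    case 1
    then show ?thesis using S(2) vol_le_1_iff[OF S(2)] by (auto simp: advance_def tile_classes_def)
  next
    case 2
    then obtain i h where Q: "tile_of \<sigma> i (exp h) Q" using assms by (auto simp: typed_def)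
    have "(i, h) \<in> tile_classes \<sigma> P" using 2 Q by (auto simp: tile_classes_def)
    moreover have "(i, h - h', j) \<in> graph_edges \<sigma>"
      using tile_classes_subst_tile[OF Q] 2(3) S(2) by (auto simp: tile_classes_def)
    moreover have "0 < h" using vol_le_1_iff[OF Q] 2(2) by auto
    ultimately show ?thesis unfolding advance_def step_def by force
  qed
next
  fix j h' assume "(j, h') \<in> ?R"
  then consider "(j, h') \<in> tile_classes \<sigma> P" "h' \<le> 0"
    | i h where "(i, h) \<in> tile_classes \<sigma> P" "0 < h" "(i, h - h', j) \<in> graph_edges \<sigma>"
    unfolding advance_def step_def by force
  then show "(j, h') \<in> ?L"
  proof cases
    case 1
    then show ?thesis using vol_le_1_iff by (auto simp: tile_classes_def subst_step_def)
  next
    case 2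
    then obtain Q where Q: "Q \<in> P" "tile_of \<sigma> i (exp h) Q" by (auto simp: tile_classes_def)
    then have "1 < vol Q" using vol_le_1_iff[OF Q(2)] 2(2) by simp
    moreover have "(j, h') \<in> tile_classes \<sigma> (subst_tile \<sigma> Q)"
      using tile_classes_subst_tile[OF Q(2)] 2(3) by simp
    ultimately show ?thesis using Q(1) by (auto simp: tile_classes_def subst_step_def)
  qed
qed

text \<open>The bridge from tilings to graphs. The least number of rounds in the definition of the flow
  exists because heights drop by at least the minimal edge length in every round.\<close>

lemma flow_front:
  assumes Q: "tile_of \<sigma> i (exp h) Q"
  shows "typed (flow \<sigma> t Q)" and "tile_classes \<sigma> (flow \<sigma> t Q) = front (i, h + t)"
proof -
  define P where "P m = (subst_step \<sigma> ^^ m) {homothet 0 (exp t) Q}" for m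
  have Q': "tile_of \<sigma> i (exp (h + t)) (homothet 0 (exp t) Q)"
    using tile_of_homothet[OF _ Q, of "exp t" 0] by (simp add: exp_add mult.commute)
  have typed: "typed (P m)" for m
    by (induction m) (use Q' in \<open>auto simp: P_def typed_def[of "{_}"] intro: typed_subst_step\<close>)
  have classes: "tile_classes \<sigma> (P m) = (advance ^^ m) {(i, h + t)}" for m
  proof (induction m)
    case 0
    then show ?case using Q' by (auto simp: P_def tile_classes_def dest: tile_of_unique)
  next
    case (Suc m)
    then show ?case using tile_classes_subst_step[OF typed[of m]] by (simp add: P_def)
  qed
  have small: "(\<forall>R \<in> P m. vol R \<le> 1) \<longleftrightarrow> (\<forall>c \<in> (advance ^^ m) {(i, h + t)}. snd c \<le> 0)" for m
    using typed[of m] vol_le_1_iff unfolding classes[symmetric] typed_def tile_classes_def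
    by fastforce
  define M where "M = (LEAST m. \<forall>R \<in> P m. vol R \<le> 1)"
  have flow: "flow \<sigma> t Q = P M" by (simp add: flow_def P_def M_def Let_def)
  have "\<exists>m. \<forall>R \<in> P m. vol R \<le> 1"
    using advance_terminates[of "(i, h + t)"] unfolding small .
  then have "\<forall>R \<in> P M. vol R \<le> 1"
    unfolding M_def by (rule LeastI_ex)
  then show "tile_classes \<sigma> (flow \<sigma> t Q) = front (i, h + t)"
    unfolding flow classes small by (rule advance_eq_front)
  show "typed (flow \<sigma> t Q)" using typed flow by simp
qed

text \<open>Two tiles of the patch are translates of each other exactly if they have the same class.\<close>

lemma card_translation_classes:
  assumes "typed P"
  shows "card (P // {(Q, R). \<exists>x. R = translate x Q}) = card (tile_classes \<sigma> P)"
proof -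
  let ?r = "{(Q, R). \<exists>x. R = translate x Q}"
  let ?f = "\<lambda>(j, h). {Q. tile_of \<sigma> j (exp h) Q}"
  have orbit: "?r `` {Q} = ?f (j, h)" if Q: "tile_of \<sigma> j (exp h) Q" for Q j h
  proof -
    have "tile_of \<sigma> j (exp h) (translate x Q)" for x
      using Q by (simp add: translate_homothet tile_of_homothet_iff)
    moreover have "\<exists>x. R = translate x Q" if R: "tile_of \<sigma> j (exp h) R" for R
    proof -
      obtain y z where "Q = homothet y (exp h) (proto \<sigma> j)" "R = homothet z (exp h) (proto \<sigma> j)"
        using Q R by (auto simp: tile_of_def)
      then have "R = translate (z - y) Q" by (simp add: translate_homothet homothet_homothet)
      then show ?thesis ..
    qed
    ultimately show ?thesis by auto
  qed
  have "inj_on ?f (tile_classes \<sigma> P)"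
  proof (rule inj_onI, clarify)
    fix j h j' h'
    assume "(j, h) \<in> tile_classes \<sigma> P"
      and eq: "{Q. tile_of \<sigma> j (exp h) Q} = {Q. tile_of \<sigma> j' (exp h') Q}"
    then obtain Q where "tile_of \<sigma> j (exp h) Q" by (auto simp: tile_classes_def)
    moreover from this eq have "tile_of \<sigma> j' (exp h') Q" by blast
    ultimately show "j = j' \<and> h = h'" using tile_of_unique by fastforce
  qed
  moreover have "?f ` tile_classes \<sigma> P = P // ?r"
  proof
    show "?f ` tile_classes \<sigma> P \<subseteq> P // ?r"
    proof (rule image_subsetI, clarify)
      fix j h assume "(j, h) \<in> tile_classes \<sigma> P"
      then obtain Q where Q: "Q \<in> P" "tile_of \<sigma> j (exp h) Q" by (auto simp: tile_classes_def)
      from Q(1) have "?r `` {Q} \<in> P // ?r" by (rule quotientI)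
      then show "{Q. tile_of \<sigma> j (exp h) Q} \<in> P // ?r" unfolding orbit[OF Q(2)] prod.case .
    qed
    show "P // ?r \<subseteq> ?f ` tile_classes \<sigma> P"
    proof
      fix X assume "X \<in> P // ?r"
      then obtain Q where Q: "Q \<in> P" "X = ?r `` {Q}" by (rule quotientE)
      then obtain j h where jh: "tile_of \<sigma> j (exp h) Q" using assms by (auto simp: typed_def)
      then have "(j, h) \<in> tile_classes \<sigma> P" using Q(1) by (auto simp: tile_classes_def)
      then show "X \<in> ?f ` tile_classes \<sigma> P" using Q(2) orbit[OF jh] by blast
    qed
  qed
  ultimately show ?thesis using card_image[of ?f "tile_classes \<sigma> P"] by (simp only:)
qed

text \<open>A tile of type \<open>i\<close> and unit volume sits at height 0, and a front contains height 0 at \<open>i\<close> exactly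
  when a walk ending at \<open>i\<close> uses up the whole height.\<close>

lemma return_times_eq:
  assumes "i < num_types \<sigma>"
  shows "return_times \<sigma> i = {t. walk i t i}"
proof -
  have proto: "tile_of \<sigma> i (exp 0) (proto \<sigma> i)" using tile_of_proto[OF assms] by simp
  have "(\<exists>Q \<in> flow \<sigma> t (proto \<sigma> i). has_type \<sigma> i Q \<and> vol Q = 1) \<longleftrightarrow>
      (i, 0) \<in> tile_classes \<sigma> (flow \<sigma> t (proto \<sigma> i))" for t
  proof
    assume "\<exists>Q \<in> flow \<sigma> t (proto \<sigma> i). has_type \<sigma> i Q \<and> vol Q = 1"
    then obtain Q h where Q: "Q \<in> flow \<sigma> t (proto \<sigma> i)" "tile_of \<sigma> i (exp h) Q" "vol Q = 1"
      using has_type_exp by blast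
    then have "h = 0" using vol_eq_1_iff by blast
    with Q show "(i, 0) \<in> tile_classes \<sigma> (flow \<sigma> t (proto \<sigma> i))"
      unfolding tile_classes_def by blast
  next
    assume "(i, 0) \<in> tile_classes \<sigma> (flow \<sigma> t (proto \<sigma> i))"
    then obtain Q where Q: "Q \<in> flow \<sigma> t (proto \<sigma> i)" "tile_of \<sigma> i (exp 0) Q"
      unfolding tile_classes_def by blast
    then have "vol Q = 1" using vol_eq_1_iff by blast
    with Q show "\<exists>Q \<in> flow \<sigma> t (proto \<sigma> i). has_type \<sigma> i Q \<and> vol Q = 1"
      using has_type_exp by blast
  qed
  then show ?thesis
    unfolding return_times_def flow_front(2)[OF proto] by (auto simp: front_zero_iff walk_nonneg)
qed

lemma irreducible_connected:
  assumes "irreducible_scheme \<sigma>" and "i < num_types \<sigma>" and "j < num_types \<sigma>"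
  shows "\<exists>x. walk i x j"
proof -
  have proto: "tile_of \<sigma> i (exp 0) (proto \<sigma> i)" using tile_of_proto[OF assms(2)] by simp
  obtain t Q where "Q \<in> flow \<sigma> t (proto \<sigma> i)" "has_type \<sigma> j Q"
    using assms unfolding irreducible_scheme_def by blast
  then obtain y where "(j, y) \<in> front (i, t)"
    using flow_front(2)[OF proto, of t] has_type_exp by (auto simp: tile_classes_def)
  then show ?thesis using steps_imp_walk unfolding front_def by fastforce
qed

text \<open>Since \<open>s\<close> is itself a positive return time, pairwise commensurability amounts to commensurability
  with \<open>s\<close>.\<close>

lemma commensurable_iff:
  assumes r: "r < num_types \<sigma>" and s: "0 < s" "walk r s r"
  shows "commensurable \<sigma> \<longleftrightarrow> (\<forall>i < num_types \<sigma>. \<forall>t > 0. walk i t i \<longrightarrow> t / s \<in> \<rat>)"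
proof
  assume comm: "commensurable \<sigma>"
  show "\<forall>i < num_types \<sigma>. \<forall>t > 0. walk i t i \<longrightarrow> t / s \<in> \<rat>"
  proof (intro allI impI)
    fix i t assume "i < num_types \<sigma>" "0 < t" "walk i t i"
    then have "t \<in> return_times \<sigma> i" "s \<in> return_times \<sigma> r"
      using r s by (simp_all add: return_times_eq)
    with comm r s \<open>i < num_types \<sigma>\<close> \<open>0 < t\<close> obtain q where "q \<in> \<rat>" "t = q * s"
      unfolding incommensurable_def by blast
    with s show "t / s \<in> \<rat>" by simp
  qed
next
  assume rat: "\<forall>i < num_types \<sigma>. \<forall>t > 0. walk i t i \<longrightarrow> t / s \<in> \<rat>"
  have "\<exists>q \<in> \<rat>. t1 = q * t2"
    if "i < num_types \<sigma>" "j < num_types \<sigma>" "0 < t1" "0 < t2" "walk i t1 i" "walk j t2 j"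
    for i j t1 t2
  proof
    show "t1 = ((t1 / s) / (t2 / s)) * t2" using that s by simp
    have "t1 / s \<in> \<rat>" "t2 / s \<in> \<rat>" using that rat by blast+
    then show "(t1 / s) / (t2 / s) \<in> \<rat>" by (rule Rats_divide)
  qed
  then show "commensurable \<sigma>" unfolding incommensurable_def by (auto simp: return_times_eq)
qed

end

section \<open>Tile complexity of stationary tilings\<close>

theorem theorem5p3:
  fixes \<sigma> :: "'a::euclidean_space scheme"
    and s :: real and T :: "'a set" and \<S> :: "'a set set"
  assumes "substitution_scheme \<sigma>" and "normalized \<sigma>" and "geometrically_distinct \<sigma>"
    and "irreducible_scheme \<sigma>"
    and "stationary_tiling \<sigma> s \<S>" and "stationary_from \<sigma> s T \<S>" and "minimal_period \<sigma> s T"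
  shows "(\<forall>l. tile_complexity \<sigma> s T (l + 1) = tile_complexity \<sigma> s T l \<longrightarrow>
              (\<forall>k\<ge>l. tile_complexity \<sigma> s T k = tile_complexity \<sigma> s T l)) \<and>
         ((\<exists>l. tile_complexity \<sigma> s T (l + 1) = tile_complexity \<sigma> s T l) \<longleftrightarrow> commensurable \<sigma>)"
proof -
  interpret multiscale_scheme \<sigma> by unfold_locales (use assms in auto)
  have s: "0 < s" using assms(5) by (auto simp: stationary_tiling_def)
  obtain r \<alpha> where "\<alpha> \<le> 1" "tile_of \<sigma> r \<alpha> T" using assms(6) by (auto simp: stationary_from_def)
  then obtain h where T: "tile_of \<sigma> r (exp h) T" and h: "h \<le> 0"
    using that[of "ln \<alpha>"] by (auto simp: tile_of_def)
  have root: "r < num_types \<sigma>" using T by (simp add: tile_of_def)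
  interpret nested_fronts "{..<num_types \<sigma>}" "graph_edges \<sigma>" r h s
  proof
    fix k
    have "flow \<sigma> (real k * s) T \<subseteq> flow \<sigma> (real (Suc k) * s) T"
      using assms(6) by (simp add: stationary_from_def subpatch_def)
    then have "tile_classes \<sigma> (flow \<sigma> (real k * s) T) \<subseteq> tile_classes \<sigma> (flow \<sigma> (real (Suc k) * s) T)"
      unfolding tile_classes_def by blast
    then show "front (r, h + real k * s) \<subseteq> front (r, h + real (Suc k) * s)"
      by (simp only: flow_front(2)[OF T])
  qed (use root s h irreducible_connected[OF assms(4)] in auto)
  have complexity: "tile_complexity \<sigma> s T k = card (classes k)" for k
    unfolding tile_complexity_def classes_def
    by (simp only: card_translation_classes[OF flow_front(1)[OF T]] flow_front(2)[OF T])
  have stable: "classes k = classes l" if "card (classes (l + 1)) = card (classes l)" "l \<le> k" for k l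
    by (rule classes_stabilise) (use that in simp_all)
  have "(\<exists>l. card (classes (l + 1)) = card (classes l)) \<longleftrightarrow> finite (\<Union>k. classes k)"
  proof
    assume "\<exists>l. card (classes (l + 1)) = card (classes l)"
    then obtain l where l: "card (classes (l + 1)) = card (classes l)" ..
    have "classes k \<subseteq> classes l" for k
      using stable[OF l, of k] classes_mono[of k l] by (cases "l \<le> k") auto
    then show "finite (\<Union>k. classes k)"
      by (intro finite_subset[OF _ finite_classes[of l]]) blast
  qed (use finite_imp_stable in simp)
  also have "\<dots> \<longleftrightarrow> commensurable \<sigma>"
    unfolding commensurable_iff[OF root s closed_walk_s]
  proof
    assume rat: "\<forall>i < num_types \<sigma>. \<forall>t > 0. walk i t i \<longrightarrow> t / s \<in> \<rat>"
    show "finite (\<Union>k. classes k)"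
    proof (rule rational_imp_finite)
      fix x assume "walk r x r"
      then show "x / s \<in> \<rat>" using rat root walk_nonneg[of r x r] by (cases "x = 0") auto
    qed
  qed (use finite_imp_rational in auto)
  finally have "(\<exists>l. card (classes (l + 1)) = card (classes l)) \<longleftrightarrow> commensurable \<sigma>" .
  then show ?thesis unfolding complexity using stable by metis
qed

end
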